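(* Let $p_1,\dots,p_m$ be $p$-values, taking values in $[0,1]$, for null hypotheses $H_1,\dots,H_m$ with fixed truth statuses, and suppose that $(p_1,\dots,p_m)$ has a continuous joint probability density on $[0,1]^m$, with marginal densities $f^{(1)},\dots,f^{(m)}$. Then for any $t\in[0,1]$ with $\sum_{i=1}^m f^{(i)}(t)>0$, $$\lim_{\varepsilon\to0}\mathrm{mFDR}([t-\varepsilon,t+\varepsilon])=\lim_{\varepsilon\to0}\mathrm{pFDR}([t-\varepsilon,t+\varepsilon])=\mathrm{lfdr}(t).$$
   Context: The frequentist local false discovery rate is $$\mathrm{lfdr}(t)=\frac{\sum_{i:\,H_i\text{ is true}} f^{(i)}(t)}{\sum_{i=1}^m f^{(i)}(t)}.$$ For an interval $[s,t]$ let $R([s,t])=\#\{i:\ p_i\in[s,t]\}$ and $V([s,t])=\#\{i:\ p_i\in[s,t],\ H_i\text{ is true}\}$. The marginal and positive false discovery rates are $$\mathrm{mFDR}([s,t])=\frac{\mathbb{E}V([s,t])}{\mathbb{E}R([s,t])},\qquad \mathrm{pFDR}([s,t])=\mathbb{E}\left[\frac{V([s,t])}{R([s,t])}\,\Big|\,R([s,t])>0\right].$$ No independence of the $p$-values is assumed. *)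

theory Defs
  imports "HOL-Probability.Probability"
begin

abbreviation unit_lborel :: "real measure" where
  "unit_lborel \<equiv> restrict_space lborel {0..1}"

(* Vectors (x_1, ..., x_m) are functions in the extensional space {1..m} \<rightarrow>\<^sub>E {0..1}.
   The i-th marginal is obtained by integrating out the coordinates j \<noteq> i.  It is this
   pointwise-defined version of the marginal density that is evaluated at single points. *)
definition marginal_density :: "nat \<Rightarrow> ((nat \<Rightarrow> real) \<Rightarrow> real) \<Rightarrow> nat \<Rightarrow> real \<Rightarrow> real" where
  "marginal_density m g i t = (\<integral>x. g (x(i := t)) \<partial>(\<Pi>\<^sub>M j\<in>{1..m} - {i}. unit_lborel))"

definition lfdr :: "nat \<Rightarrow> (nat \<Rightarrow> bool) \<Rightarrow> (nat \<Rightarrow> real \<Rightarrow> real) \<Rightarrow> real \<Rightarrow> real" where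
  "lfdr m H f t = (\<Sum>i | i \<in> {1..m} \<and> H i. f i t) / (\<Sum>i\<in>{1..m}. f i t)"

definition num_R :: "nat \<Rightarrow> (nat \<Rightarrow> 'a \<Rightarrow> real) \<Rightarrow> real set \<Rightarrow> 'a \<Rightarrow> nat" where
  "num_R m p A \<omega> = card {i \<in> {1..m}. p i \<omega> \<in> A}"

definition num_V :: "nat \<Rightarrow> (nat \<Rightarrow> bool) \<Rightarrow> (nat \<Rightarrow> 'a \<Rightarrow> real) \<Rightarrow> real set \<Rightarrow> 'a \<Rightarrow> nat" where
  "num_V m H p A \<omega> = card {i \<in> {1..m}. p i \<omega> \<in> A \<and> H i}"

definition mFDR ::
  "'a measure \<Rightarrow> nat \<Rightarrow> (nat \<Rightarrow> bool) \<Rightarrow> (nat \<Rightarrow> 'a \<Rightarrow> real) \<Rightarrow> real set \<Rightarrow> real" where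
  "mFDR M m H p A =
    (\<integral>\<omega>. real (num_V m H p A \<omega>) \<partial>M) / (\<integral>\<omega>. real (num_R m p A \<omega>) \<partial>M)"

(* For an event B of positive probability, uniform_measure M B is the conditional
   probability measure given B, i.e. C \<mapsto> P (B \<inter> C) / P B. *)
definition pFDR ::
  "'a measure \<Rightarrow> nat \<Rightarrow> (nat \<Rightarrow> bool) \<Rightarrow> (nat \<Rightarrow> 'a \<Rightarrow> real) \<Rightarrow> real set \<Rightarrow> real" where
  "pFDR M m H p A =
    (\<integral>\<omega>. real (num_V m H p A \<omega>) / real (num_R m p A \<omega>)
      \<partial>(uniform_measure M {\<omega> \<in> space M. num_R m p A \<omega> > 0}))"

end

theory Submission
  imports Defs
begin

text \<open>
  Write \<open>R\<close> and \<open>V\<close> for the numbers of all \<open>p\<close>-values and of true-null \<open>p\<close>-values in the window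
  \<open>[t - \<epsilon>, t + \<epsilon>]\<close>, and \<open>w\<close> for the length of the part of that window inside \<open>[0,1]\<close>.  This part
  has positive length even when \<open>t\<close> is an endpoint, and \<open>w\<close> tends to \<open>0\<close>.  Everything is
  compared with \<open>w\<close>.

  A continuous density on the compact cube is bounded, say by \<open>B\<close>, so dominated convergence makes each
  marginal density continuous on \<open>[0,1]\<close>.  The probability that \<open>p\<^sub>i\<close> falls in the window is the
  integral of the \<open>i\<close>-th marginal over it, hence equals \<open>w\<close> times the value of that marginal at \<open>t\<close>,
  up to \<open>o(w)\<close> (\<open>prob_window_tendsto\<close>).  Summing over \<open>i\<close> gives the limits of \<open>E V / w\<close> and
  \<open>E R / w\<close>, whose quotient is the limit of the mFDR.

  For the pFDR, which is \<open>E (V / R)\<close> divided by the probability of \<open>R > 0\<close> (with \<open>0 / 0 = 0\<close>), the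
  point is that two \<open>p\<close>-values rarely share a small window.  Both \<open>V - V / R\<close> and
  \<open>R\<close> minus the indicator of \<open>R > 0\<close> lie between \<open>0\<close> and \<open>R (R - 1)\<close>, the number of ordered pairs of
  distinct \<open>p\<close>-values in the window.  Since the density is at most \<open>B\<close>, a given pair does so with
  probability at most \<open>B w\<^sup>2\<close> (\<open>prob_p_in_both\<close>), so \<open>E (R (R - 1))\<close> is at most \<open>m\<^sup>2 B w\<^sup>2 = o(w)\<close>.  Hence
  numerator and denominator of the pFDR have, after division by \<open>w\<close>, the same limits as \<open>E V\<close> and
  \<open>E R\<close>.  Boundedness of the joint density thus does the work for which one might expect independence.
\<close>

section \<open>Windows in the unit interval\<close>

lemma prob_space_unit_lborel: "prob_space unit_lborel"
  by (rule prob_space_restrict_space) auto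

lemma space_unit_lborel [simp]: "space unit_lborel = {0..1}"
  by (simp add: space_restrict_space)

lemma borel_measurable_unit_lborel_ident [measurable]:
  "(\<lambda>s. s) \<in> borel_measurable unit_lborel"
  by (rule measurable_restrict_space1) simp

lemma borel_measurable_unit_lborelI:
  fixes f :: "real \<Rightarrow> real"
  assumes "continuous_on {0..1} f"
  shows "f \<in> borel_measurable unit_lborel"
proof -
  have "sets (restrict_space borel {0..1 :: real}) = sets unit_lborel"
    by (rule sets_restrict_space_cong) simp
  then show ?thesis
    using borel_measurable_continuous_on_restrict[OF assms] measurable_cong_sets by blast
qed

text \<open>
  Intersecting with \<open>{0..1}\<close> is needed for the intended value: the measure of a set that is not a
  subset of the space is \<open>0\<close> by convention.
\<close>

definition window_length :: "real \<Rightarrow> real \<Rightarrow> real" where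
  "window_length t \<epsilon> = measure unit_lborel ({t - \<epsilon>..t + \<epsilon>} \<inter> {0..1})"

lemma window_length_eq:
  assumes "t \<in> {0..1}" "\<epsilon> > 0"
  shows "window_length t \<epsilon> = min 1 (t + \<epsilon>) - max 0 (t - \<epsilon>)"
proof -
  have "{t - \<epsilon>..t + \<epsilon>} \<inter> {0..1} = {max 0 (t - \<epsilon>)..min 1 (t + \<epsilon>)}"
    by auto
  then show ?thesis
    unfolding window_length_def using assms by (subst measure_restrict_space) auto
qed

lemma window_length_pos:
  assumes "t \<in> {0..1}" "\<epsilon> > 0"
  shows "window_length t \<epsilon> > 0"
  using assms by (auto simp: window_length_eq)

lemma window_length_tendsto_0:
  assumes "t \<in> {0..1}"
  shows "(window_length t \<longlongrightarrow> 0) (at_right 0)"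
proof -
  have "((\<lambda>\<epsilon>. min 1 (t + \<epsilon>) - max 0 (t - \<epsilon>)) \<longlongrightarrow> min 1 (t + 0) - max 0 (t - 0)) (at_right 0)"
    by (intro tendsto_intros)
  then have "((\<lambda>\<epsilon>. min 1 (t + \<epsilon>) - max 0 (t - \<epsilon>)) \<longlongrightarrow> 0) (at_right 0)"
    using assms by simp
  then show ?thesis
    by (rule Lim_transform_eventually) (use assms in \<open>auto simp: eventually_at_filter window_length_eq\<close>)
qed

text \<open>
  Lebesgue differentiation at a point of continuity.  When \<open>t\<close> is an endpoint the average is one-sided,
  because the integral only sees \<open>[0,1]\<close> and \<open>window_length\<close> is the length of what it sees.
\<close>

lemma window_average_tendsto:
  fixes f :: "real \<Rightarrow> real"
  assumes f: "continuous_on {0..1} f" and t: "t \<in> {0..1}"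
  shows "((\<lambda>\<epsilon>. (\<integral>s. indicator {t - \<epsilon>..t + \<epsilon>} s * f s \<partial>unit_lborel) / window_length t \<epsilon>)
           \<longlongrightarrow> f t) (at_right 0)"
proof (rule tendstoI)
  fix e :: real assume "e > 0"
  interpret U: prob_space unit_lborel by (rule prob_space_unit_lborel)
  have [measurable]: "f \<in> borel_measurable unit_lborel"
    using f by (rule borel_measurable_unit_lborelI)
  obtain \<delta> where \<delta>: "\<delta> > 0" "\<And>s. s \<in> {0..1} \<Longrightarrow> \<bar>s - t\<bar> < \<delta> \<Longrightarrow> \<bar>f s - f t\<bar> < e / 2"
    using f t \<open>e > 0\<close> unfolding continuous_on_iff dist_real_def by (metis half_gt_zero)
  have "bounded (f ` {0..1})"
    using f by (intro compact_imp_bounded compact_continuous_image) auto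
  then obtain C where C: "\<And>s. s \<in> {0..1} \<Longrightarrow> \<bar>f s\<bar> \<le> C"
    unfolding bounded_real by blast
  have "dist ((\<integral>s. indicator {t - \<epsilon>..t + \<epsilon>} s * f s \<partial>unit_lborel) / window_length t \<epsilon>) (f t) < e"
    if \<epsilon>: "0 < \<epsilon>" "\<epsilon> < \<delta>" for \<epsilon>
  proof -
    define A where "A = {t - \<epsilon>..t + \<epsilon>}"
    define w where "w = window_length t \<epsilon>"
    have w: "w > 0" using window_length_pos t \<epsilon> by (simp add: w_def)
    have [measurable]: "A \<in> sets borel" by (simp add: A_def)
    have ind [measurable]: "(indicator A :: real \<Rightarrow> real) \<in> borel_measurable unit_lborel"
      by (rule measurable_restrict_space1) simp
    have int_f: "integrable unit_lborel (\<lambda>s. indicator A s * f s)"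
      by (rule U.integrable_const_bound[where B = "\<bar>C\<bar>"])
         (use C in \<open>force simp: indicator_def intro!: AE_I2 split: if_splits\<close>, measurable)
    have int_1: "integrable unit_lborel (indicator A :: real \<Rightarrow> real)"
      by (rule U.integrable_const_bound[where B = 1]) (auto simp: indicator_def)
    have w_int: "w = (\<integral>s. indicator A s \<partial>unit_lborel)"
      by (simp add: w_def window_length_def A_def)
    have "\<bar>(\<integral>s. indicator A s * f s \<partial>unit_lborel) - f t * w\<bar>
        = \<bar>\<integral>s. indicator A s * f s - indicator A s * f t \<partial>unit_lborel\<bar>"
      unfolding w_int using int_f int_1 by (simp add: mult.commute)
    also have "\<dots> \<le> (\<integral>s. indicator A s * (e / 2) \<partial>unit_lborel)"
    proof (rule integral_abs_bound[THEN order_trans], rule integral_mono)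
      fix s assume "s \<in> space unit_lborel"
      then show "\<bar>indicator A s * f s - indicator A s * f t\<bar> \<le> indicator A s * (e / 2)"
        using \<delta>(2)[of s] \<epsilon> by (cases "s \<in> A") (auto simp: A_def abs_less_iff less_imp_le)
    qed (use int_f int_1 in auto)
    also have "\<dots> = w * (e / 2)"
      unfolding w_int using int_1 by simp
    finally have "\<bar>(\<integral>s. indicator A s * f s \<partial>unit_lborel) - f t * w\<bar> < w * e"
      using w \<open>e > 0\<close> by (simp add: field_simps) (smt (verit) mult_pos_pos)
    moreover have "(\<integral>s. indicator A s * f s \<partial>unit_lborel) / w - f t
        = ((\<integral>s. indicator A s * f s \<partial>unit_lborel) - f t * w) / w"
      using w by (simp add: field_simps)
    ultimately show ?thesis
      using w unfolding dist_real_def A_def[symmetric] w_def[symmetric]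
      by (simp add: abs_divide divide_less_eq mult.commute)
  qed
  then show "eventually (\<lambda>\<epsilon>. dist ((\<integral>s. indicator {t - \<epsilon>..t + \<epsilon>} s * f s \<partial>unit_lborel)
      / window_length t \<epsilon>) (f t) < e) (at_right 0)"
    using \<delta>(1) unfolding eventually_at_right_field by blast
qed

text \<open>
  The form in which all first-order asymptotics are used: the normalisation by the window
  length cancels in a quotient.
\<close>

lemma window_ratio_tendsto:
  assumes t: "t \<in> {0..1}"
    and "((\<lambda>\<epsilon>. a \<epsilon> / window_length t \<epsilon>) \<longlongrightarrow> k) (at_right 0)"
    and "((\<lambda>\<epsilon>. b \<epsilon> / window_length t \<epsilon>) \<longlongrightarrow> l) (at_right 0)" and "l \<noteq> 0"
  shows "((\<lambda>\<epsilon>. a \<epsilon> / b \<epsilon>) \<longlongrightarrow> k / l) (at_right 0)"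
proof (rule Lim_transform_eventually[OF tendsto_divide[OF assms(2-4)]])
  have "a \<epsilon> / window_length t \<epsilon> / (b \<epsilon> / window_length t \<epsilon>) = a \<epsilon> / b \<epsilon>" if "\<epsilon> > 0" for \<epsilon>
    using window_length_pos[OF t that] by simp
  then show "eventually (\<lambda>\<epsilon>. a \<epsilon> / window_length t \<epsilon> / (b \<epsilon> / window_length t \<epsilon>) = a \<epsilon> / b \<epsilon>) (at_right 0)"
    by (simp add: eventually_at_filter)
qed

section \<open>Continuous joint densities on the unit cube\<close>

text \<open>
  Extensional functions on \<open>I\<close> form a full product once the coordinates outside \<open>I\<close> are given the
  singleton factor \<open>{undefined}\<close>; Tychonoff then applies, for arbitrary \<open>I\<close>.
\<close>

lemma compact_unit_cube: "compact (I \<rightarrow>\<^sub>E {0..1 :: real})"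
proof -
  have "I \<rightarrow>\<^sub>E {0..1 :: real} = PiE UNIV (\<lambda>i. if i \<in> I then {0..1} else {undefined})"
    by (auto simp: PiE_def Pi_def extensional_def split: if_splits)
  moreover have "compactin (product_topology (\<lambda>_. euclidean) UNIV)
      (PiE UNIV (\<lambda>i. if i \<in> I then {0..1 :: real} else {undefined}))"
    by (subst compactin_PiE) auto
  ultimately show ?thesis
    by (simp add: euclidean_product_topology)
qed

lemma card_eq_sum_indicator:
  assumes "finite I"
  shows "real (card {i \<in> I. f i \<in> A}) = (\<Sum>i\<in>I. indicator A (f i))"
  using assms by (simp add: indicator_def Int_def)

lemma enn2real_divide_ennreal:
  assumes "a \<ge> 0" "b \<ge> 0"
  shows "enn2real (ennreal a / ennreal b) = a / b"
  using assms by (cases "b = 0") (auto simp: divide_ennreal less_le)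

locale continuous_p_values = prob_space M for M :: "'a measure" +
  fixes m :: nat and p :: "nat \<Rightarrow> 'a \<Rightarrow> real" and g :: "(nat \<Rightarrow> real) \<Rightarrow> real"
  assumes density_nonneg: "x \<in> {1..m} \<rightarrow>\<^sub>E {0..1} \<Longrightarrow> g x \<ge> 0"
    and density_continuous: "continuous_on ({1..m} \<rightarrow>\<^sub>E {0..1}) g"
    and joint_density: "distributed M (\<Pi>\<^sub>M i\<in>{1..m}. unit_lborel)
      (\<lambda>\<omega>. \<lambda>i\<in>{1..m}. p i \<omega>) (\<lambda>x. ennreal (g x))"
begin

abbreviation cube :: "nat set \<Rightarrow> (nat \<Rightarrow> real) measure" where
  "cube I \<equiv> (\<Pi>\<^sub>M i\<in>I. unit_lborel)"

lemma space_cube: "space (cube I) = I \<rightarrow>\<^sub>E {0..1}"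
  by (simp add: space_PiM)

lemma prob_space_cube: "prob_space (cube I)"
  by (rule prob_space_PiM) (rule prob_space_unit_lborel)

lemma product_prob_space_unit: "product_prob_space (\<lambda>_::nat. unit_lborel)"
  by (rule product_prob_spaceI) (rule prob_space_unit_lborel)

lemma density_measurable [measurable]: "g \<in> borel_measurable (cube {1..m})"
  by (rule distributed_real_measurable[OF _ joint_density]) (auto simp: space_cube density_nonneg)

lemma density_bounded:
  obtains B where "B > 0" "\<And>x. x \<in> {1..m} \<rightarrow>\<^sub>E {0..1} \<Longrightarrow> g x \<le> B"
proof -
  have "bounded (g ` ({1..m} \<rightarrow>\<^sub>E {0..1}))"
    by (intro compact_imp_bounded compact_continuous_image density_continuous compact_unit_cube)
  then obtain B where B: "\<And>x. x \<in> {1..m} \<rightarrow>\<^sub>E {0..1} \<Longrightarrow> \<bar>g x\<bar> \<le> B"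
    unfolding bounded_iff by auto
  show ?thesis
    by (rule that[of "\<bar>B\<bar> + 1"]) (use B in force)+
qed

lemma p_measurable [measurable]:
  assumes "i \<in> {1..m}"
  shows "p i \<in> borel_measurable M"
proof -
  have "(\<lambda>\<omega>. (\<lambda>i\<in>{1..m}. p i \<omega>) i) \<in> measurable M unit_lborel"
    by (rule measurable_compose[OF distributed_measurable[OF joint_density]
          measurable_component_singleton]) fact
  then have "p i \<in> measurable M unit_lborel"
    using assms by simp
  from measurable_compose[OF this borel_measurable_unit_lborel_ident] show ?thesis .
qed

lemma update_in_cube:
  assumes "i \<in> {1..m}" "x \<in> ({1..m} - {i}) \<rightarrow>\<^sub>E {0..1}" "s \<in> {0..1::real}"
  shows "x(i := s) \<in> {1..m} \<rightarrow>\<^sub>E {0..1}"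
  using assms by (auto simp: PiE_def Pi_def extensional_def)

lemma section_measurable:
  assumes "i \<in> {1..m}" "s \<in> {0..1}"
  shows "(\<lambda>x. g (x(i := s))) \<in> borel_measurable (cube ({1..m} - {i}))"
  by (rule measurable_compose[OF _ density_measurable], rule measurable_fun_upd[where J = "{1..m} - {i}"])
     (use assms in auto)

lemma section_integrable:
  assumes "i \<in> {1..m}" "s \<in> {0..1}"
  shows "integrable (cube ({1..m} - {i})) (\<lambda>x. g (x(i := s)))"
proof -
  interpret Q: prob_space "cube ({1..m} - {i})" by (rule prob_space_cube)
  obtain B where B: "\<And>x. x \<in> {1..m} \<rightarrow>\<^sub>E {0..1} \<Longrightarrow> g x \<le> B"
    using density_bounded by blast
  show ?thesis
    by (rule Q.integrable_const_bound[where B = B])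
       (use B density_nonneg update_in_cube assms section_measurable in
         \<open>auto intro!: AE_I2 simp: space_cube\<close>)
qed

text \<open>
  Dominated convergence: the sections of \<open>g\<close> are continuous in the distinguished coordinate and share
  the bound of \<open>g\<close>, which is integrable over a cube of total mass \<open>1\<close>.
\<close>

lemma continuous_on_marginal_density:
  assumes i: "i \<in> {1..m}"
  shows "continuous_on {0..1} (marginal_density m g i)"
proof -
  interpret Q: prob_space "cube ({1..m} - {i})" by (rule prob_space_cube)
  obtain B where B: "\<And>x. x \<in> {1..m} \<rightarrow>\<^sub>E {0..1} \<Longrightarrow> g x \<le> B"
    using density_bounded by blast
  have "(\<lambda>n. marginal_density m g i (u n)) \<longlonglongrightarrow> marginal_density m g i s"
    if s: "s \<in> {0..1}" and u: "\<And>n. u n \<in> {0..1}" "u \<longlonglongrightarrow> s" for u s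
    unfolding marginal_density_def
  proof (rule integral_dominated_convergence[where w = "\<lambda>_. B"])
    show "AE x in cube ({1..m} - {i}). (\<lambda>n. g (x(i := u n))) \<longlonglongrightarrow> g (x(i := s))"
    proof (rule AE_I2)
      fix x assume "x \<in> space (cube ({1..m} - {i}))"
      then have x: "x \<in> ({1..m} - {i}) \<rightarrow>\<^sub>E {0..1}" by (simp add: space_cube)
      have "continuous_on UNIV (\<lambda>s. (x(i := s)) k)" for k
        by (cases "k = i") auto
      then have "continuous_on UNIV (\<lambda>s. x(i := s))"
        by (rule continuous_on_coordinatewise_then_product)
      then have "continuous_on {0..1} (\<lambda>s. x(i := s))"
        by (rule continuous_on_subset) simp
      then have "continuous_on {0..1} (\<lambda>s. g (x(i := s)))"
        by (rule continuous_on_compose2[OF density_continuous]) (use update_in_cube i x in blast)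
      with s u show "(\<lambda>n. g (x(i := u n))) \<longlonglongrightarrow> g (x(i := s))"
        unfolding continuous_on_sequentially comp_def by blast
    qed
    show "AE x in cube ({1..m} - {i}). norm (g (x(i := u n))) \<le> B" for n
      using B density_nonneg update_in_cube i u by (auto intro!: AE_I2 simp: space_cube)
    show "integrable (cube ({1..m} - {i})) (\<lambda>_. B)" by (rule Q.integrable_const)
  qed (use section_measurable i s u in auto)
  then show ?thesis
    unfolding continuous_on_sequentially comp_def by blast
qed

lemma marginal_density_nonneg:
  assumes "i \<in> {1..m}" "s \<in> {0..1}"
  shows "marginal_density m g i s \<ge> 0"
  unfolding marginal_density_def
  by (rule integral_nonneg_AE)
     (use assms density_nonneg update_in_cube in \<open>auto intro!: AE_I2 simp: space_cube\<close>)

text \<open>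
  Fubini, integrating out the coordinates other than \<open>i\<close> first.  This ties the pointwise-defined
  marginal density to the distribution of \<open>p i\<close>.
\<close>

lemma prob_p_in:
  assumes i: "i \<in> {1..m}" and [measurable]: "A \<in> sets borel"
  shows "prob {\<omega> \<in> space M. p i \<omega> \<in> A}
    = (\<integral>s. indicator A s * marginal_density m g i s \<partial>unit_lborel)"
proof -
  interpret U: product_prob_space "\<lambda>_::nat. unit_lborel" by (rule product_prob_space_unit)
  let ?X = "\<lambda>\<omega>. \<lambda>i\<in>{1..m}. p i \<omega>"
  define S where "S = {x \<in> space (cube {1..m}). x i \<in> A}"
  have comp [measurable]: "(\<lambda>x. x i) \<in> borel_measurable (cube {1..m})"
    by (rule measurable_compose[OF measurable_component_singleton[OF i]
          borel_measurable_unit_lborel_ident])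
  have [measurable]: "S \<in> sets (cube {1..m})"
    unfolding S_def by measurable
  have ins: "insert i ({1..m} - {i}) = {1..m}" using i by auto
  have [measurable]: "(indicator A :: real \<Rightarrow> real) \<in> borel_measurable unit_lborel"
    by (rule measurable_restrict_space1) simp
  have mm [measurable]: "marginal_density m g i \<in> borel_measurable unit_lborel"
    using continuous_on_marginal_density[OF i] by (rule borel_measurable_unit_lborelI)
  have "emeasure M {\<omega> \<in> space M. p i \<omega> \<in> A} = emeasure M (?X -` S \<inter> space M)"
    using i measurable_space[OF distributed_measurable[OF joint_density]]
    by (intro arg_cong[where f = "emeasure M"]) (auto simp: S_def)
  also have "\<dots> = (\<integral>\<^sup>+x. ennreal (g x) * indicator S x \<partial>cube {1..m})"
    by (rule distributed_emeasure[OF joint_density]) measurable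
  also have "\<dots> = (\<integral>\<^sup>+s. (\<integral>\<^sup>+x. ennreal (g (x(i := s))) * indicator S (x(i := s))
      \<partial>cube ({1..m} - {i})) \<partial>unit_lborel)"
  proof (rule U.product_nn_integral_insert_rev[of "{1..m} - {i}" i, unfolded ins])
    show "(\<lambda>x. ennreal (g x) * indicator S x) \<in> borel_measurable (cube {1..m})" by measurable
  qed auto
  also have "\<dots> = (\<integral>\<^sup>+s. ennreal (indicator A s * marginal_density m g i s) \<partial>unit_lborel)"
  proof (rule nn_integral_cong)
    fix s assume "s \<in> space unit_lborel"
    then have s: "s \<in> {0..1}" by simp
    have "(\<integral>\<^sup>+x. ennreal (g (x(i := s))) * indicator S (x(i := s)) \<partial>cube ({1..m} - {i}))
        = (\<integral>\<^sup>+x. ennreal (g (x(i := s))) * indicator A s \<partial>cube ({1..m} - {i}))"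
      using update_in_cube i s
      by (intro nn_integral_cong) (auto simp: S_def space_cube indicator_def)
    also have "\<dots> = (\<integral>\<^sup>+x. ennreal (g (x(i := s))) \<partial>cube ({1..m} - {i})) * indicator A s"
      using section_measurable i s by (intro nn_integral_multc) auto
    also have "(\<integral>\<^sup>+x. ennreal (g (x(i := s))) \<partial>cube ({1..m} - {i}))
        = ennreal (marginal_density m g i s)"
      unfolding marginal_density_def
      by (rule nn_integral_eq_integral[OF section_integrable])
         (use i s density_nonneg update_in_cube in \<open>auto intro!: AE_I2 simp: space_cube\<close>)
    finally show "(\<integral>\<^sup>+x. ennreal (g (x(i := s))) * indicator S (x(i := s)) \<partial>cube ({1..m} - {i}))
        = ennreal (indicator A s * marginal_density m g i s)"
      by (cases "s \<in> A") (simp_all add: fun_upd_def)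
  qed
  finally have "prob {\<omega> \<in> space M. p i \<omega> \<in> A}
      = enn2real (\<integral>\<^sup>+s. ennreal (indicator A s * marginal_density m g i s) \<partial>unit_lborel)"
    by (simp add: measure_def)
  also have "\<dots> = (\<integral>s. indicator A s * marginal_density m g i s \<partial>unit_lborel)"
    by (rule integral_eq_nn_integral[symmetric])
       (use marginal_density_nonneg[OF i] in \<open>auto intro!: AE_I2\<close>)
  finally show ?thesis .
qed

text \<open>
  Under the uniform distribution on the cube, two coordinates constrained to the same set cost two
  factors of its length, and a bounded density can increase this by at most the factor \<open>B\<close>.
\<close>

lemma prob_p_in_both:
  assumes B: "B \<ge> 0" "\<And>x. x \<in> {1..m} \<rightarrow>\<^sub>E {0..1} \<Longrightarrow> g x \<le> B"
    and ij: "i \<in> {1..m}" "j \<in> {1..m}" "i \<noteq> j" and [measurable]: "A \<in> sets borel"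
  shows "prob {\<omega> \<in> space M. p i \<omega> \<in> A \<and> p j \<omega> \<in> A} \<le> B * (measure unit_lborel (A \<inter> {0..1}))\<^sup>2"
proof -
  interpret U: product_prob_space "\<lambda>_::nat. unit_lborel" "{1..m}"
    by (rule product_prob_space_unit)
  let ?X = "\<lambda>\<omega>. \<lambda>i\<in>{1..m}. p i \<omega>"
  let ?w = "measure unit_lborel (A \<inter> {0..1})"
  define S where "S = {x \<in> space (cube {1..m}). \<forall>k\<in>{i, j}. x k \<in> A \<inter> {0..1}}"
  have A: "A \<inter> {0..1} \<in> sets unit_lborel"
    by (auto simp: sets_restrict_space)
  have comp: "(\<lambda>x. x k) \<in> borel_measurable (cube {1..m})" if "k \<in> {1..m}" for k
    by (rule measurable_compose[OF measurable_component_singleton[OF that]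
          borel_measurable_unit_lborel_ident])
  note comp[OF ij(1), measurable] comp[OF ij(2), measurable]
  have [measurable]: "S \<in> sets (cube {1..m})"
  proof -
    have "S = {x \<in> space (cube {1..m}). x i \<in> A \<inter> {0..1} \<and> x j \<in> A \<inter> {0..1}}"
      by (auto simp: S_def)
    also have "\<dots> \<in> sets (cube {1..m})" by measurable
    finally show ?thesis .
  qed
  have eS: "emeasure (cube {1..m}) S = ennreal (?w\<^sup>2)"
    unfolding S_def using ij A
    by (subst U.emeasure_PiM_Collect)
       (auto simp: U.M.emeasure_eq_measure power2_eq_square ennreal_mult)
  have "emeasure M {\<omega> \<in> space M. p i \<omega> \<in> A \<and> p j \<omega> \<in> A} = emeasure M (?X -` S \<inter> space M)"
    using ij measurable_space[OF distributed_measurable[OF joint_density]]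
    by (intro arg_cong[where f = "emeasure M"]) (force simp: S_def space_cube)
  also have "\<dots> = (\<integral>\<^sup>+x. ennreal (g x) * indicator S x \<partial>cube {1..m})"
    by (rule distributed_emeasure[OF joint_density]) measurable
  also have "\<dots> \<le> (\<integral>\<^sup>+x. ennreal B * indicator S x \<partial>cube {1..m})"
    by (intro nn_integral_mono mult_right_mono ennreal_leI B) (auto simp: space_cube)
  also have "\<dots> = ennreal (B * ?w\<^sup>2)"
    using B(1) \<open>S \<in> sets (cube {1..m})\<close>
    by (subst nn_integral_cmult_indicator) (auto simp only: eS ennreal_mult zero_le_power2)
  finally show ?thesis
    using B(1) by (simp add: emeasure_eq_measure ennreal_le_iff)
qed

section \<open>Expected counts\<close>

lemma num_R_eq_sum: "real (num_R m p A \<omega>) = (\<Sum>i\<in>{1..m}. indicator A (p i \<omega>))"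
  unfolding num_R_def by (rule card_eq_sum_indicator) simp

lemma num_V_eq_sum:
  "real (num_V m H p A \<omega>) = (\<Sum>i | i \<in> {1..m} \<and> H i. indicator A (p i \<omega>))"
proof -
  have "{i \<in> {1..m}. p i \<omega> \<in> A \<and> H i} = {i \<in> {i. i \<in> {1..m} \<and> H i}. p i \<omega> \<in> A}"
    by auto
  then show ?thesis
    unfolding num_V_def by (simp only:) (rule card_eq_sum_indicator, simp)
qed

lemma num_V_le_num_R: "num_V m H p A \<omega> \<le> num_R m p A \<omega>"
  unfolding num_V_def num_R_def by (rule card_mono) auto

lemma indicator_p_integrable:
  assumes "i \<in> {1..m}" and [measurable]: "A \<in> sets borel"
  shows "integrable M (\<lambda>\<omega>. indicator A (p i \<omega>) :: real)"
proof -
  note p_measurable[OF assms(1), measurable]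
  show ?thesis
    by (rule integrable_const_bound[where B = 1]) (auto simp: indicator_def)
qed

lemma expectation_indicator_p:
  assumes "i \<in> {1..m}" and [measurable]: "A \<in> sets borel"
  shows "(\<integral>\<omega>. indicator A (p i \<omega>) \<partial>M :: real) = prob {\<omega> \<in> space M. p i \<omega> \<in> A}"
proof -
  have "(\<integral>\<omega>. indicator A (p i \<omega>) \<partial>M :: real) = (\<integral>\<omega>. indicator {\<omega> \<in> space M. p i \<omega> \<in> A} \<omega> \<partial>M)"
    by (rule Bochner_Integration.integral_cong) (auto simp: indicator_def)
  then show ?thesis
    by (simp add: Int_def conj_commute)
qed

lemma expectation_num_R:
  assumes "A \<in> sets borel"
  shows "(\<integral>\<omega>. real (num_R m p A \<omega>) \<partial>M) = (\<Sum>i\<in>{1..m}. prob {\<omega> \<in> space M. p i \<omega> \<in> A})"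
  unfolding num_R_eq_sum using assms
  by (simp add: indicator_p_integrable expectation_indicator_p)

lemma expectation_num_V:
  assumes "A \<in> sets borel"
  shows "(\<integral>\<omega>. real (num_V m H p A \<omega>) \<partial>M)
    = (\<Sum>i | i \<in> {1..m} \<and> H i. prob {\<omega> \<in> space M. p i \<omega> \<in> A})"
  unfolding num_V_eq_sum using assms
  by (simp add: indicator_p_integrable expectation_indicator_p)

lemma num_R_measurable:
  assumes [measurable]: "A \<in> sets borel"
  shows "(\<lambda>\<omega>. real (num_R m p A \<omega>)) \<in> borel_measurable M"
  unfolding num_R_eq_sum
  by (intro borel_measurable_sum borel_measurable_integrable indicator_p_integrable) auto

lemma num_V_measurable:
  assumes [measurable]: "A \<in> sets borel"
  shows "(\<lambda>\<omega>. real (num_V m H p A \<omega>)) \<in> borel_measurable M"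
  unfolding num_V_eq_sum
  by (intro borel_measurable_sum borel_measurable_integrable indicator_p_integrable) auto

lemma num_R_le: "num_R m p A \<omega> \<le> m"
proof -
  have "num_R m p A \<omega> \<le> card {1..m}" unfolding num_R_def by (rule card_mono) auto
  then show ?thesis by simp
qed

text \<open>
  The number of ordered pairs of distinct indices whose \<open>p\<close>-values both lie in \<open>A\<close>, as a real number
  so that \<open>R = 0\<close> needs no truncated subtraction.
\<close>

definition ordered_pairs :: "real set \<Rightarrow> 'a \<Rightarrow> real" where
  "ordered_pairs A \<omega> = real (num_R m p A \<omega>) * (real (num_R m p A \<omega>) - 1)"

text \<open>
  Squaring a sum of indicators and removing the diagonal, on which each indicator is its own square.
\<close>

lemma ordered_pairs_eq_sum:
  "ordered_pairs A \<omega>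
    = (\<Sum>i\<in>{1..m}. \<Sum>j\<in>{1..m} - {i}. indicator A (p i \<omega>) * indicator A (p j \<omega>))"
proof -
  let ?a = "\<lambda>i. indicator A (p i \<omega>) :: real"
  have "(\<Sum>j\<in>{1..m} - {i}. ?a i * ?a j) = ?a i * (\<Sum>j\<in>{1..m}. ?a j) - ?a i" if "i \<in> {1..m}" for i
  proof -
    have "(\<Sum>j\<in>{1..m}. ?a i * ?a j) = ?a i * ?a i + (\<Sum>j\<in>{1..m} - {i}. ?a i * ?a j)"
      using that by (intro sum.remove) auto
    moreover have "?a i * ?a i = ?a i"
      by (simp add: indicator_def)
    ultimately show ?thesis
      unfolding sum_distrib_left by linarith
  qed
  then have "(\<Sum>i\<in>{1..m}. \<Sum>j\<in>{1..m} - {i}. ?a i * ?a j)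
      = (\<Sum>i\<in>{1..m}. ?a i * (\<Sum>j\<in>{1..m}. ?a j) - ?a i)"
    by (rule sum.cong[OF refl])
  also have "\<dots> = (\<Sum>i\<in>{1..m}. ?a i) * (\<Sum>j\<in>{1..m}. ?a j) - (\<Sum>i\<in>{1..m}. ?a i)"
    by (simp add: sum_subtractf sum_distrib_right)
  finally show ?thesis
    unfolding ordered_pairs_def num_R_eq_sum by (simp add: algebra_simps)
qed

lemma expectation_ordered_pairs_le:
  assumes B: "B \<ge> 0" "\<And>x. x \<in> {1..m} \<rightarrow>\<^sub>E {0..1} \<Longrightarrow> g x \<le> B"
    and A [measurable]: "A \<in> sets borel"
  shows "(\<integral>\<omega>. ordered_pairs A \<omega> \<partial>M) \<le> (real m)\<^sup>2 * (B * (measure unit_lborel (A \<inter> {0..1}))\<^sup>2)"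
proof -
  let ?c = "B * (measure unit_lborel (A \<inter> {0..1}))\<^sup>2"
  have c: "?c \<ge> 0" using B(1) by simp
  have pair: "integrable M (\<lambda>\<omega>. indicator A (p i \<omega>) * indicator A (p j \<omega>) :: real)
      \<and> (\<integral>\<omega>. indicator A (p i \<omega>) * indicator A (p j \<omega>) \<partial>M :: real) \<le> ?c"
    if ij: "i \<in> {1..m}" "j \<in> {1..m} - {i}" for i j
  proof
    have j: "j \<in> {1..m}" "i \<noteq> j" using ij(2) by auto
    note p_measurable[OF ij(1), measurable] p_measurable[OF j(1), measurable]
    show "integrable M (\<lambda>\<omega>. indicator A (p i \<omega>) * indicator A (p j \<omega>) :: real)"
      by (rule integrable_const_bound[where B = 1]) (auto simp: indicator_def)
    have "(\<integral>\<omega>. indicator A (p i \<omega>) * indicator A (p j \<omega>) \<partial>M :: real)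
        = (\<integral>\<omega>. indicator {\<omega> \<in> space M. p i \<omega> \<in> A \<and> p j \<omega> \<in> A} \<omega> \<partial>M)"
      by (rule Bochner_Integration.integral_cong) (auto simp: indicator_def)
    also have "\<dots> = prob {\<omega> \<in> space M. p i \<omega> \<in> A \<and> p j \<omega> \<in> A}"
      by (simp add: Int_def conj_commute conj_left_commute)
    also have "\<dots> \<le> ?c"
      by (rule prob_p_in_both[OF B ij(1) j A])
    finally show "(\<integral>\<omega>. indicator A (p i \<omega>) * indicator A (p j \<omega>) \<partial>M :: real) \<le> ?c" .
  qed
  have "(\<integral>\<omega>. ordered_pairs A \<omega> \<partial>M)
      = (\<Sum>i\<in>{1..m}. \<Sum>j\<in>{1..m} - {i}. \<integral>\<omega>. indicator A (p i \<omega>) * indicator A (p j \<omega>) \<partial>M)"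
    unfolding ordered_pairs_eq_sum
  proof (subst Bochner_Integration.integral_sum)
    show "integrable M (\<lambda>\<omega>. \<Sum>j\<in>{1..m} - {i}. indicator A (p i \<omega>) * indicator A (p j \<omega>) :: real)"
      if "i \<in> {1..m}" for i
      using pair[OF that] by (intro Bochner_Integration.integrable_sum) blast
    show "(\<Sum>i\<in>{1..m}. \<integral>\<omega>. (\<Sum>j\<in>{1..m} - {i}. indicator A (p i \<omega>) * indicator A (p j \<omega>)) \<partial>M)
        = (\<Sum>i\<in>{1..m}. \<Sum>j\<in>{1..m} - {i}.
            \<integral>\<omega>. indicator A (p i \<omega>) * indicator A (p j \<omega>) \<partial>M :: real)"
      using pair by (intro sum.cong refl Bochner_Integration.integral_sum) blast
  qed
  also have "\<dots> \<le> (\<Sum>i\<in>{1..m}. \<Sum>j\<in>{1..m} - {i}. ?c)"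
    using pair by (intro sum_mono) blast
  also have "\<dots> \<le> (\<Sum>i\<in>{1..m}. \<Sum>j\<in>{1..m}. ?c)"
    using c by (intro sum_mono sum_mono2) auto
  also have "\<dots> = (real m)\<^sup>2 * ?c"
    by (simp add: power2_eq_square)
  finally show ?thesis .
qed

text \<open>
  Conditioning only rescales: on the event \<open>R = 0\<close> the ratio \<open>V / R\<close> is \<open>0 / 0 = 0\<close>, so restricting
  the integral to \<open>R > 0\<close> does not change it.  The identity also holds when \<open>R > 0\<close> has probability
  \<open>0\<close>, both sides then being \<open>0\<close>.
\<close>

lemma pFDR_eq:
  assumes [measurable]: "A \<in> sets borel"
  shows "pFDR M m H p A = (\<integral>\<omega>. real (num_V m H p A \<omega>) / real (num_R m p A \<omega>) \<partial>M)
    / prob {\<omega> \<in> space M. num_R m p A \<omega> > 0}"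
proof -
  let ?S = "{\<omega> \<in> space M. num_R m p A \<omega> > 0}"
  let ?q = "\<lambda>\<omega>. real (num_V m H p A \<omega>) / real (num_R m p A \<omega>)"
  note num_R_measurable[OF assms, measurable] num_V_measurable[OF assms, measurable]
  have "?S = {\<omega> \<in> space M. real (num_R m p A \<omega>) > 0}" by auto
  also have "\<dots> \<in> sets M" by measurable
  finally have S [measurable]: "?S \<in> sets M" .
  have q [measurable]: "?q \<in> borel_measurable M" by measurable
  have "integrable M ?q"
    by (rule integrable_const_bound[where B = 1]) (auto simp: divide_le_eq_1 num_V_le_num_R)
  then have I: "(\<integral>\<^sup>+\<omega>. ennreal (?q \<omega>) \<partial>M) = ennreal (\<integral>\<omega>. ?q \<omega> \<partial>M)"
    by (rule nn_integral_eq_integral) simp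
  have "pFDR M m H p A = enn2real (\<integral>\<^sup>+\<omega>. ennreal (?q \<omega>) \<partial>uniform_measure M ?S)"
    unfolding pFDR_def
    by (rule integral_eq_nn_integral) (auto intro!: AE_I2 simp: measurable_cong_sets[OF sets_uniform_measure refl] q)
  also have "(\<integral>\<^sup>+\<omega>. ennreal (?q \<omega>) \<partial>uniform_measure M ?S)
      = (\<integral>\<^sup>+\<omega>. ennreal (?q \<omega>) * indicator ?S \<omega> \<partial>M) / emeasure M ?S"
    by (rule nn_integral_uniform_measure) measurable
  also have "(\<integral>\<^sup>+\<omega>. ennreal (?q \<omega>) * indicator ?S \<omega> \<partial>M) = (\<integral>\<^sup>+\<omega>. ennreal (?q \<omega>) \<partial>M)"
    by (rule nn_integral_cong) (auto simp: indicator_def)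
  also have "enn2real (\<dots> / emeasure M ?S) = (\<integral>\<omega>. ?q \<omega> \<partial>M) / prob ?S"
    unfolding I emeasure_eq_measure by (rule enn2real_divide_ennreal) simp_all
  finally show ?thesis .
qed

lemma bounded_integrable:
  fixes X :: "'a \<Rightarrow> real"
  assumes "X \<in> borel_measurable M" "\<And>\<omega>. \<bar>X \<omega>\<bar> \<le> c"
  shows "integrable M X"
  using assms by (intro integrable_const_bound[where B = c]) auto

lemma num_R_integrable:
  "A \<in> sets borel \<Longrightarrow> integrable M (\<lambda>\<omega>. real (num_R m p A \<omega>))"
  by (rule bounded_integrable[where c = "real m"]) (auto simp: num_R_measurable num_R_le)

lemma ordered_pairs_integrable:
  assumes "A \<in> sets borel"
  shows "integrable M (ordered_pairs A)"
proof (rule bounded_integrable[where c = "real m * real m"])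
  show "ordered_pairs A \<in> borel_measurable M"
    unfolding ordered_pairs_def[abs_def] using num_R_measurable[OF assms] by measurable
  fix \<omega>
  have "num_R m p A \<omega> * (num_R m p A \<omega> - 1) \<le> m * m"
    by (rule mult_le_mono) (use num_R_le[of A \<omega>] in auto)
  moreover have "ordered_pairs A \<omega> = real (num_R m p A \<omega> * (num_R m p A \<omega> - 1))"
    by (cases "num_R m p A \<omega>") (auto simp: ordered_pairs_def algebra_simps)
  ultimately show "\<bar>ordered_pairs A \<omega>\<bar> \<le> real m * real m"
    by (metis abs_of_nat of_nat_le_iff of_nat_mult)
qed

lemma expectation_difference_le_ordered_pairs:
  fixes X Y :: "'a \<Rightarrow> real"
  assumes "A \<in> sets borel" "integrable M X" "integrable M Y"
    and "\<And>\<omega>. \<omega> \<in> space M \<Longrightarrow> \<bar>X \<omega> - Y \<omega>\<bar> \<le> ordered_pairs A \<omega>"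
  shows "\<bar>(\<integral>\<omega>. X \<omega> \<partial>M) - (\<integral>\<omega>. Y \<omega> \<partial>M)\<bar> \<le> (\<integral>\<omega>. ordered_pairs A \<omega> \<partial>M)"
proof -
  have "\<bar>(\<integral>\<omega>. X \<omega> \<partial>M) - (\<integral>\<omega>. Y \<omega> \<partial>M)\<bar> = \<bar>\<integral>\<omega>. X \<omega> - Y \<omega> \<partial>M\<bar>"
    using assms by simp
  also have "\<dots> \<le> (\<integral>\<omega>. \<bar>X \<omega> - Y \<omega>\<bar> \<partial>M)"
    by (rule integral_abs_bound)
  also have "\<dots> \<le> (\<integral>\<omega>. ordered_pairs A \<omega> \<partial>M)"
    using assms ordered_pairs_integrable by (intro integral_mono) auto
  finally show ?thesis .
qed

text \<open>
  The indicator of \<open>R > 0\<close> and \<open>R\<close> agree unless \<open>R \<ge> 2\<close>, and then they differ by \<open>R - 1 \<le> R (R - 1)\<close>.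
\<close>

lemma prob_num_R_pos_approx:
  assumes A: "A \<in> sets borel"
  shows "\<bar>prob {\<omega> \<in> space M. num_R m p A \<omega> > 0} - (\<integral>\<omega>. real (num_R m p A \<omega>) \<partial>M)\<bar>
    \<le> (\<integral>\<omega>. ordered_pairs A \<omega> \<partial>M)"
proof -
  let ?S = "{\<omega> \<in> space M. num_R m p A \<omega> > 0}"
  have "?S = {\<omega> \<in> space M. real (num_R m p A \<omega>) > 0}" by auto
  also have "\<dots> \<in> sets M" using num_R_measurable[OF A] by measurable
  finally have S: "?S \<in> sets M" .
  have "\<bar>(\<integral>\<omega>. indicator ?S \<omega> \<partial>M) - (\<integral>\<omega>. real (num_R m p A \<omega>) \<partial>M)\<bar>
      \<le> (\<integral>\<omega>. ordered_pairs A \<omega> \<partial>M)"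
  proof (rule expectation_difference_le_ordered_pairs[OF A _ num_R_integrable[OF A]])
    show "integrable M (indicator ?S :: 'a \<Rightarrow> real)"
      using S by (simp add: emeasure_eq_measure)
    show "\<bar>indicator ?S \<omega> - real (num_R m p A \<omega>)\<bar> \<le> ordered_pairs A \<omega>" if "\<omega> \<in> space M" for \<omega>
      using that by (cases "num_R m p A \<omega>") (auto simp: ordered_pairs_def algebra_simps)
  qed
  then show ?thesis using S by (simp add: sets.Int_space_eq2)
qed

text \<open>
  For \<open>R \<ge> 1\<close> one has \<open>V - V / R = (V / R) (R - 1)\<close> with \<open>V / R \<le> 1 \<le> R\<close>; for \<open>R = 0\<close> also \<open>V = 0\<close>.
\<close>

lemma expectation_ratio_approx:
  assumes A: "A \<in> sets borel"
  shows "\<bar>(\<integral>\<omega>. real (num_V m H p A \<omega>) / real (num_R m p A \<omega>) \<partial>M)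
      - (\<integral>\<omega>. real (num_V m H p A \<omega>) \<partial>M)\<bar> \<le> (\<integral>\<omega>. ordered_pairs A \<omega> \<partial>M)"
proof (rule expectation_difference_le_ordered_pairs[OF A])
  note num_R_measurable[OF A, measurable] num_V_measurable[OF A, measurable]
  show "integrable M (\<lambda>\<omega>. real (num_V m H p A \<omega>) / real (num_R m p A \<omega>))"
    by (rule bounded_integrable[where c = 1]) (auto simp: divide_le_eq_1 num_V_le_num_R)
  show "integrable M (\<lambda>\<omega>. real (num_V m H p A \<omega>))"
    by (rule bounded_integrable[where c = "real m"])
       (auto intro: order_trans[OF num_V_le_num_R num_R_le])
  fix \<omega>
  let ?V = "real (num_V m H p A \<omega>)" and ?R = "real (num_R m p A \<omega>)"
  have VR: "0 \<le> ?V" "?V \<le> ?R" using num_V_le_num_R by auto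
  show "\<bar>?V / ?R - ?V\<bar> \<le> ordered_pairs A \<omega>"
  proof (cases "num_R m p A \<omega> = 0")
    case True
    then show ?thesis using VR by (simp add: ordered_pairs_def)
  next
    case False
    then have R: "?R \<ge> 1" by (simp add: Suc_le_eq)
    have "?V - ?V / ?R = ?V / ?R * (?R - 1)"
      using R by (simp add: field_simps)
    moreover have "0 \<le> ?V / ?R * (?R - 1)"
      using R VR by simp
    moreover have "?V / ?R * (?R - 1) \<le> ?R * (?R - 1)"
    proof (rule mult_right_mono)
      have "?V / ?R \<le> 1" using R VR by simp
      then show "?V / ?R \<le> ?R" using R by linarith
    qed (use R in simp)
    ultimately show ?thesis unfolding ordered_pairs_def by linarith
  qed
qed

section \<open>Shrinking the window\<close>

lemma prob_window_tendsto:
  assumes "i \<in> {1..m}" "t \<in> {0..1}"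
  shows "((\<lambda>\<epsilon>. prob {\<omega> \<in> space M. p i \<omega> \<in> {t - \<epsilon>..t + \<epsilon>}} / window_length t \<epsilon>)
    \<longlongrightarrow> marginal_density m g i t) (at_right 0)"
proof -
  have "prob {\<omega> \<in> space M. p i \<omega> \<in> {t - \<epsilon>..t + \<epsilon>}}
      = (\<integral>s. indicator {t - \<epsilon>..t + \<epsilon>} s * marginal_density m g i s \<partial>unit_lborel)" for \<epsilon>
    by (rule prob_p_in[OF assms(1)]) simp
  then show ?thesis
    using window_average_tendsto[OF continuous_on_marginal_density[OF assms(1)] assms(2)] by simp
qed

lemma expectation_num_R_window_tendsto:
  assumes "t \<in> {0..1}"
  shows "((\<lambda>\<epsilon>. (\<integral>\<omega>. real (num_R m p {t - \<epsilon>..t + \<epsilon>} \<omega>) \<partial>M) / window_length t \<epsilon>)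
    \<longlongrightarrow> (\<Sum>i\<in>{1..m}. marginal_density m g i t)) (at_right 0)"
  unfolding expectation_num_R[OF atLeastAtMost_borel] sum_divide_distrib
  by (rule tendsto_sum) (rule prob_window_tendsto[OF _ assms])

lemma expectation_num_V_window_tendsto:
  assumes "t \<in> {0..1}"
  shows "((\<lambda>\<epsilon>. (\<integral>\<omega>. real (num_V m H p {t - \<epsilon>..t + \<epsilon>} \<omega>) \<partial>M) / window_length t \<epsilon>)
    \<longlongrightarrow> (\<Sum>i | i \<in> {1..m} \<and> H i. marginal_density m g i t)) (at_right 0)"
  unfolding expectation_num_V[OF atLeastAtMost_borel] sum_divide_distrib
  by (rule tendsto_sum) (rule prob_window_tendsto[OF _ assms], simp)

text \<open>
  The expected number of pairs is of second order in the window length, hence negligible against it.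
\<close>

lemma expectation_ordered_pairs_window_tendsto:
  assumes t: "t \<in> {0..1}"
  shows "((\<lambda>\<epsilon>. (\<integral>\<omega>. ordered_pairs {t - \<epsilon>..t + \<epsilon>} \<omega> \<partial>M) / window_length t \<epsilon>) \<longlongrightarrow> 0) (at_right 0)"
proof -
  obtain B where B: "B > 0" "\<And>x. x \<in> {1..m} \<rightarrow>\<^sub>E {0..1} \<Longrightarrow> g x \<le> B"
    using density_bounded by blast
  let ?N = "\<lambda>\<epsilon>. \<integral>\<omega>. ordered_pairs {t - \<epsilon>..t + \<epsilon>} \<omega> \<partial>M"
  have ub: "?N \<epsilon> / window_length t \<epsilon> \<le> (real m)\<^sup>2 * B * window_length t \<epsilon>" if "\<epsilon> > 0" for \<epsilon>
  proof -
    have "?N \<epsilon> \<le> (real m)\<^sup>2 * (B * (window_length t \<epsilon>)\<^sup>2)"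
      unfolding window_length_def
      by (rule expectation_ordered_pairs_le) (use B in auto)
    then show ?thesis
      using window_length_pos[OF t that] by (simp add: divide_le_eq power2_eq_square mult_ac)
  qed
  have lb: "0 \<le> ?N \<epsilon> / window_length t \<epsilon>" for \<epsilon>
  proof -
    have "0 \<le> ordered_pairs {t - \<epsilon>..t + \<epsilon>} \<omega>" for \<omega>
      unfolding ordered_pairs_eq_sum by (intro sum_nonneg) auto
    then show ?thesis by (simp add: window_length_def)
  qed
  have "((\<lambda>\<epsilon>. (real m)\<^sup>2 * B * window_length t \<epsilon>) \<longlongrightarrow> 0) (at_right 0)"
    using tendsto_mult_right_zero[OF window_length_tendsto_0[OF t]] .
  then show ?thesis
    by (rule tendsto_sandwich[rotated 3, where f = "\<lambda>_. 0"])
       (use ub lb in \<open>auto simp: eventually_at_filter\<close>)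
qed

lemma window_perturbation_tendsto:
  assumes t: "t \<in> {0..1}"
    and b: "((\<lambda>\<epsilon>. b \<epsilon> / window_length t \<epsilon>) \<longlongrightarrow> l) (at_right 0)"
    and ab: "\<And>\<epsilon>. \<bar>a \<epsilon> - b \<epsilon>\<bar> \<le> (\<integral>\<omega>. ordered_pairs {t - \<epsilon>..t + \<epsilon>} \<omega> \<partial>M)"
  shows "((\<lambda>\<epsilon>. a \<epsilon> / window_length t \<epsilon>) \<longlongrightarrow> l) (at_right 0)"
proof -
  have "((\<lambda>\<epsilon>. (a \<epsilon> - b \<epsilon>) / window_length t \<epsilon>) \<longlongrightarrow> 0) (at_right 0)"
  proof (rule Lim_null_comparison[OF _ expectation_ordered_pairs_window_tendsto[OF t]])
    show "eventually (\<lambda>\<epsilon>. norm ((a \<epsilon> - b \<epsilon>) / window_length t \<epsilon>)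
        \<le> (\<integral>\<omega>. ordered_pairs {t - \<epsilon>..t + \<epsilon>} \<omega> \<partial>M) / window_length t \<epsilon>) (at_right 0)"
      using ab by (intro always_eventually) (simp add: window_length_def divide_right_mono)
  qed
  from tendsto_add[OF this b] show ?thesis
    by (simp add: diff_divide_distrib)
qed

end

theorem theorem3p1:
  fixes M :: "'a measure"
    and m :: nat
    and H :: "nat \<Rightarrow> bool"
    and p :: "nat \<Rightarrow> 'a \<Rightarrow> real"
    and g :: "(nat \<Rightarrow> real) \<Rightarrow> real"
    and t :: real
  assumes "prob_space M"
    and "\<And>i \<omega>. i \<in> {1..m} \<Longrightarrow> \<omega> \<in> space M \<Longrightarrow> p i \<omega> \<in> {0..1}"
    and "\<And>x. x \<in> {1..m} \<rightarrow>\<^sub>E {0..1} \<Longrightarrow> g x \<ge> 0"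
    and "continuous_on ({1..m} \<rightarrow>\<^sub>E {0..1}) g"
    and "distributed M (\<Pi>\<^sub>M i\<in>{1..m}. unit_lborel) (\<lambda>\<omega>. \<lambda>i\<in>{1..m}. p i \<omega>) (\<lambda>x. ennreal (g x))"
    and "t \<in> {0..1}"
    and "(\<Sum>i\<in>{1..m}. marginal_density m g i t) > 0"
  shows "((\<lambda>\<epsilon>. mFDR M m H p {t - \<epsilon>..t + \<epsilon>}) \<longlongrightarrow> lfdr m H (marginal_density m g) t) (at_right 0)
       \<and> ((\<lambda>\<epsilon>. pFDR M m H p {t - \<epsilon>..t + \<epsilon>}) \<longlongrightarrow> lfdr m H (marginal_density m g) t) (at_right 0)"
proof -
  interpret prob_space M by fact
  interpret continuous_p_values M m p g
    using assms(3-5) by unfold_locales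
  let ?A = "\<lambda>\<epsilon>. {t - \<epsilon>..t + \<epsilon>}"
  note t = \<open>t \<in> {0..1}\<close>
  have nz: "(\<Sum>i\<in>{1..m}. marginal_density m g i t) \<noteq> 0" using assms(7) by simp
  have "((\<lambda>\<epsilon>. mFDR M m H p (?A \<epsilon>)) \<longlongrightarrow> lfdr m H (marginal_density m g) t) (at_right 0)"
    unfolding mFDR_def lfdr_def
    by (intro window_ratio_tendsto[OF t] expectation_num_V_window_tendsto
        expectation_num_R_window_tendsto t nz)
  moreover have "((\<lambda>\<epsilon>. pFDR M m H p (?A \<epsilon>)) \<longlongrightarrow> lfdr m H (marginal_density m g) t) (at_right 0)"
  proof -
    have "((\<lambda>\<epsilon>. (\<integral>\<omega>. real (num_V m H p (?A \<epsilon>) \<omega>) / real (num_R m p (?A \<epsilon>) \<omega>) \<partial>M)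
          / window_length t \<epsilon>)
        \<longlongrightarrow> (\<Sum>i | i \<in> {1..m} \<and> H i. marginal_density m g i t)) (at_right 0)"
      by (rule window_perturbation_tendsto[OF t expectation_num_V_window_tendsto[OF t]
            expectation_ratio_approx]) simp
    moreover have "((\<lambda>\<epsilon>. prob {\<omega> \<in> space M. num_R m p (?A \<epsilon>) \<omega> > 0} / window_length t \<epsilon>)
        \<longlongrightarrow> (\<Sum>i\<in>{1..m}. marginal_density m g i t)) (at_right 0)"
      by (rule window_perturbation_tendsto[OF t expectation_num_R_window_tendsto[OF t]
            prob_num_R_pos_approx]) simp
    ultimately show ?thesis
      unfolding lfdr_def pFDR_eq[OF atLeastAtMost_borel]
      by (rule window_ratio_tendsto[OF t _ _ nz])
  qed
  ultimately show ?thesis by blast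
qed

end
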